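(* Let $\pi$ be a strictly positive probability vector on $V=\{1,\dots,n\}$, let $Q$ be an irreducible transition-rate matrix on $V$ that is reversible with respect to $\pi$, and let $\omega_{ij}=\pi_iQ_{ij}$. Let $F_{r_0}:(0,\infty)\to\mathbb{R}$, $r_0\in(0,\infty)$, be a family of functions such that for every $r_0>0$: 1) $F_{r_0}(r)\ge 0$ for all $r>0$, with equality if and only if $r=r_0$; 2) $\lim_{r\to0+}F_{r_0}(r)=\infty$; 3) $F_{r_0}$ is strictly decreasing on $(0,r_0]$; 4) for every fixed $r\in(0,r_0]$ and every $r_1>r_0$ one has $F_{r_1}(r)>F_{r_0}(r)$. Let the potential be $$\mathcal{U}(p)=\frac14\sum_{i,j=1}^n F_{p_i/\pi_i}\Big(\frac{p_j}{\pi_j}\Big)\,\omega_{ij},$$ and let $(p(t),\psi(t))$ be a solution, with $p(0)\in\mathbb{P}(V)$, of the damped Hamiltonian dynamics $$\frac{\mathrm{d}p_i}{\mathrm{d}t}+\sum_{j\ne i}\omega_{ij}\theta_{ij}(p)(\psi_j-\psi_i)=0,\qquad \frac{\mathrm{d}\psi_i}{\mathrm{d}t}+\gamma(t)\psi_i+\frac12\sum_{j\neq i}\omega_{ij}\frac{\partial\theta_{ij}(p)}{\partial p_i}(\psi_i-\psi_j)^2+\frac{\partial\mathcal{U}(p)}{\partial p_i}=0,\quad i=1,\dots,n.$$ Suppose that $\mathcal{H}(p(0),\psi(0))$ is bounded (finite) and $p_i(0)>0$ for all $i$. Then there exists a constant $\varepsilon>0$ such that $p_i(t)>\varepsilon$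 for every $i\in V$ and every time $t\ge0$ at which the solution is defined.
   Context: Vectors are row vectors. $\mathbb{P}(V)=\{p\in\mathbb{R}^n: p_i\ge0,\ \sum_ip_i=1\}$. A transition-rate matrix $Q$ has $Q_{ij}\ge0$ for $i\ne j$ and $Q_{ii}=-\sum_{j\ne i}Q_{ij}$. It is irreducible if for any two states $i\neq j$ there is a path $i=i_1,\dots,i_m=j$ with $Q_{i_ki_{k+1}}>0$ for all $k$. It is reversible with respect to $\pi$ if $\pi_iQ_{ij}=\pi_jQ_{ji}$ for all $i,j$; thus $\omega$ is symmetric and defines a connected weighted undirected graph $G=(V,E,\omega)$. The mobility weights $\theta_{ij}(p)=\theta_{ji}(p)$ are positive and continuously differentiable in $p\in(0,\infty)^n$. They are either constants $\theta_{ij}=\theta_{ji}>0$ or of the form $\theta_{ij}(p)=\theta(p_i/\pi_i,p_j/\pi_j)$ with $\theta(x,y)=\frac{x-y}{f'(x)-f'(y)}$ for $x\ne y$ and $\theta(x,x)=1/f''(x)$, where $f$ is a convex function with $f(1)=0$ and $f''>0$ on $(0,\infty)$. The damping parameter $\gamma(t)$ is positive. The Hamiltonian is $\mathcal{H}(p,\psi)=\frac14\sum_{i=1}^n\sum_{j\ne i}\omega_{ij}\theta_{ij}(p)(\psi_i-\psi_j)^2+\mathcal{U}(p)$. The potential $\mathcal{U}$ is defined and continuously differentiable for $p\in(0,\infty)^n$, and (by the paper's standing convention on potentials) its unique critical point on the simplex is $\pi$. A solution $(p(t),\psi(t))$ is a differentiable curve on a time interval starting at $0$, with $p(t)$ in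 the domain $(0,\infty)^n$, satisfying the equations. *)

theory Defs
  imports "HOL-Analysis.Analysis"
begin

definition prob_simplex :: "(real ^ 'n) set" where
  "prob_simplex = {p. (\<forall>i. 0 \<le> p $ i) \<and> (\<Sum>i\<in>UNIV. p $ i) = 1}"

definition pos_orthant :: "(real ^ 'n) set" where
  "pos_orthant = {p. \<forall>i. 0 < p $ i}"

text \<open>Continuous differentiability, with the derivative represented by its gradient field.\<close>

definition C1_on :: "(real ^ 'n) set \<Rightarrow> (real ^ 'n \<Rightarrow> real) \<Rightarrow> bool" where
  "C1_on S g \<longleftrightarrow>
     (\<exists>D. (\<forall>p\<in>S. (g has_derivative (\<lambda>h. D p \<bullet> h)) (at p)) \<and> continuous_on S D)"

definition partial_deriv :: "(real ^ 'n \<Rightarrow> real) \<Rightarrow> 'n \<Rightarrow> real ^ 'n \<Rightarrow> real" where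
  "partial_deriv g i p = deriv (\<lambda>h. g (p + h *\<^sub>R axis i 1)) 0"

definition rate_matrix :: "real ^ 'n ^ 'n \<Rightarrow> bool" where
  "rate_matrix Q \<longleftrightarrow>
     (\<forall>i j. i \<noteq> j \<longrightarrow> 0 \<le> Q $ i $ j) \<and>
     (\<forall>i. Q $ i $ i = - (\<Sum>j\<in>UNIV - {i}. Q $ i $ j))"

definition irreducible_rates :: "real ^ 'n ^ 'n \<Rightarrow> bool" where
  "irreducible_rates Q \<longleftrightarrow>
     (\<forall>i j. i \<noteq> j \<longrightarrow> (i, j) \<in> {(k, l). 0 < Q $ k $ l}\<^sup>*)"

definition reversible_rates :: "real ^ 'n \<Rightarrow> real ^ 'n ^ 'n \<Rightarrow> bool" where
  "reversible_rates \<pi> Q \<longleftrightarrow> (\<forall>i j. \<pi> $ i * Q $ i $ j = \<pi> $ j * Q $ j $ i)"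

definition edge_weight :: "real ^ 'n \<Rightarrow> real ^ 'n ^ 'n \<Rightarrow> 'n \<Rightarrow> 'n \<Rightarrow> real" where
  "edge_weight \<pi> Q i j = \<pi> $ i * Q $ i $ j"

definition divergence_mobility :: "(real \<Rightarrow> real) \<Rightarrow> real \<Rightarrow> real \<Rightarrow> real" where
  "divergence_mobility f x y =
     (if x = y then 1 / deriv (deriv f) x else (x - y) / (deriv f x - deriv f y))"

text \<open>The diagonal entries of \<open>\<theta>\<close> never enter the dynamics and are left unconstrained.\<close>

definition mobility_weights ::
    "real ^ 'n \<Rightarrow> ('n \<Rightarrow> 'n \<Rightarrow> real ^ 'n \<Rightarrow> real) \<Rightarrow> bool" where
  "mobility_weights \<pi> \<theta> \<longleftrightarrow>
     (\<forall>i j. i \<noteq> j \<longrightarrow>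
        C1_on pos_orthant (\<theta> i j) \<and>
        (\<forall>p\<in>pos_orthant. 0 < \<theta> i j p \<and> \<theta> i j p = \<theta> j i p)) \<and>
     ((\<exists>c. \<forall>i j. i \<noteq> j \<longrightarrow> (\<forall>p\<in>pos_orthant. \<theta> i j p = c i j)) \<or>
      (\<exists>f. convex_on {0<..} f \<and> f 1 = 0 \<and>
           (\<forall>x>0. f differentiable at x \<and> deriv f differentiable at x \<and>
                  0 < deriv (deriv f) x) \<and>
           (\<forall>i j. i \<noteq> j \<longrightarrow> (\<forall>p\<in>pos_orthant.
              \<theta> i j p = divergence_mobility f (p $ i / \<pi> $ i) (p $ j / \<pi> $ j)))))"

definition hamiltonian ::
    "('n \<Rightarrow> 'n \<Rightarrow> real) \<Rightarrow> ('n \<Rightarrow> 'n \<Rightarrow> real ^ 'n \<Rightarrow> real) \<Rightarrow> (real ^ 'n \<Rightarrow> real) \<Rightarrow>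
     real ^ 'n \<Rightarrow> real ^ 'n \<Rightarrow> real" where
  "hamiltonian \<omega> \<theta> U p \<psi> =
     (1 / 4) * (\<Sum>i\<in>UNIV. \<Sum>j\<in>UNIV - {i}. \<omega> i j * \<theta> i j p * (\<psi> $ i - \<psi> $ j)\<^sup>2) + U p"

text \<open>
  Critical points of the restriction of \<open>U\<close> to the simplex: only the derivatives in the tangent
  directions, whose entries sum to zero, have to vanish. As \<open>U\<close> is only meaningful on the positive
  orthant, only the relative interior of the simplex is considered.
\<close>

definition critical_on_simplex :: "(real ^ 'n \<Rightarrow> real) \<Rightarrow> real ^ 'n \<Rightarrow> bool" where
  "critical_on_simplex U q \<longleftrightarrow>
     q \<in> prob_simplex \<inter> pos_orthant \<and>
     (\<forall>v :: real ^ 'n. (\<Sum>i\<in>UNIV. v $ i) = 0 \<longrightarrow> (\<Sum>i\<in>UNIV. partial_deriv U i q * v $ i) = 0)"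

definition admissible_potential :: "real ^ 'n \<Rightarrow> (real ^ 'n \<Rightarrow> real) \<Rightarrow> bool" where
  "admissible_potential \<pi> U \<longleftrightarrow>
     C1_on pos_orthant U \<and> (\<forall>q. critical_on_simplex U q \<longleftrightarrow> q = \<pi>)"

definition graph_potential ::
    "(real \<Rightarrow> real \<Rightarrow> real) \<Rightarrow> real ^ 'n \<Rightarrow> ('n \<Rightarrow> 'n \<Rightarrow> real) \<Rightarrow> real ^ 'n \<Rightarrow> real" where
  "graph_potential F \<pi> \<omega> p =
     (1 / 4) * (\<Sum>i\<in>UNIV. \<Sum>j\<in>UNIV. F (p $ i / \<pi> $ i) (p $ j / \<pi> $ j) * \<omega> i j)"

text \<open>
  \<open>I\<close> is any interval with left endpoint \<open>0 \<in> I\<close>, bounded or not; derivatives are one-sided at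
  endpoints belonging to \<open>I\<close>.
\<close>

definition damped_solution ::
    "('n \<Rightarrow> 'n \<Rightarrow> real) \<Rightarrow> ('n \<Rightarrow> 'n \<Rightarrow> real ^ 'n \<Rightarrow> real) \<Rightarrow> (real ^ 'n \<Rightarrow> real) \<Rightarrow>
     (real \<Rightarrow> real) \<Rightarrow> real set \<Rightarrow> (real \<Rightarrow> real ^ 'n) \<Rightarrow> (real \<Rightarrow> real ^ 'n) \<Rightarrow> bool" where
  "damped_solution \<omega> \<theta> U \<gamma> I p \<psi> \<longleftrightarrow>
     is_interval I \<and> 0 \<in> I \<and> I \<subseteq> {0..} \<and>
     (\<forall>t\<in>I. p t \<in> pos_orthant) \<and>
     (\<exists>p' \<psi>'. \<forall>t\<in>I.
        (p has_vector_derivative p' t) (at t within I) \<and>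
        (\<psi> has_vector_derivative \<psi>' t) (at t within I) \<and>
        (\<forall>i. p' t $ i +
               (\<Sum>j\<in>UNIV - {i}. \<omega> i j * \<theta> i j (p t) * (\<psi> t $ j - \<psi> t $ i)) = 0 \<and>
             \<psi>' t $ i + \<gamma> t * \<psi> t $ i +
               (1 / 2) * (\<Sum>j\<in>UNIV - {i}.
                  \<omega> i j * partial_deriv (\<theta> i j) i (p t) * (\<psi> t $ i - \<psi> t $ j)\<^sup>2) +
               partial_deriv U i (p t) = 0))"

end

theory Submission
  imports Defs
begin

text \<open>
  The Hamiltonian is a Lyapunov function: along a solution its derivative is
  \<open>- \<gamma> / 2\<close> times the weighted Dirichlet sum of \<open>\<psi>\<close> over ordered pairs, hence nonpositive. This is where the
  special form of the mobilities matters: \<open>\<theta> i j\<close> depends on \<open>p $ i\<close> and \<open>p $ j\<close> only, so that the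
  equation for \<open>\<psi> $ i\<close> contains all of the \<open>i\<close>-th partial derivative of the kinetic energy
  (\<open>mobility_has_derivative\<close>, \<open>power_balance\<close>, \<open>hamiltonian_antimono\<close>). The kinetic energy is
  nonnegative, so the potential stays below its initial energy level for all times.

  The potential in turn is a barrier. Its terms are nonnegative, so a bound on \<open>U\<close> bounds
  \<open>F (r i) (r j)\<close> for every edge, where \<open>r i = p $ i / \<pi> $ i\<close>. As \<open>F (r i) (r j)\<close> grows with \<open>r i\<close>
  as long as \<open>r j \<le> r i\<close>, and explodes when \<open>r j\<close> tends to zero, a lower bound on \<open>r i\<close> propagates to every neighbour \<open>j\<close>
  (\<open>barrier\<close>), and by irreducibility from one state to all (\<open>barrier_along_path\<close>). The starting
  point is conservation of mass: as \<open>p\<close> and \<open>\<pi>\<close> have the same total mass, some \<open>r i\<close> is at least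
  \<open>1\<close>. All constants depend on the energy level only, hence not on time.
\<close>

section \<open>Sums over ordered pairs of distinct indices\<close>

lemma sum_off_diagonal_swap:
  fixes g :: "'a::finite \<Rightarrow> 'a \<Rightarrow> real"
  shows "(\<Sum>i\<in>UNIV. \<Sum>j\<in>UNIV - {i}. g i j) = (\<Sum>i\<in>UNIV. \<Sum>j\<in>UNIV - {i}. g j i)"
proof -
  have eq: "UNIV - {i} = {j\<in>UNIV. i \<noteq> j}" "UNIV - {i} = {j\<in>UNIV. j \<noteq> i}" for i :: 'a
    by auto
  have "(\<Sum>i\<in>UNIV. \<Sum>j\<in>{j\<in>UNIV. i \<noteq> j}. g i j) = (\<Sum>j\<in>UNIV. \<Sum>i\<in>{i\<in>UNIV. i \<noteq> j}. g i j)"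
    by (rule sum.swap_restrict) auto
  then show ?thesis
    using eq by simp
qed

text \<open>Summation by parts on the graph: the weighted graph Laplacian is symmetric.\<close>

lemma graph_green_formula:
  fixes k :: "'a::finite \<Rightarrow> 'a \<Rightarrow> real"
  assumes sym: "\<And>i j. i \<noteq> j \<Longrightarrow> k i j = k j i"
  shows "(\<Sum>i\<in>UNIV. \<Sum>j\<in>UNIV - {i}. k i j * (y i - y j) * (z i - z j)) =
         2 * (\<Sum>i\<in>UNIV. z i * (\<Sum>j\<in>UNIV - {i}. k i j * (y i - y j)))"
proof -
  have "(\<Sum>i\<in>UNIV. \<Sum>j\<in>UNIV - {i}. k i j * (y i - y j) * (z i - z j)) =
      (\<Sum>i\<in>UNIV. \<Sum>j\<in>UNIV - {i}. z i * (k i j * (y i - y j))) +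
      (\<Sum>i\<in>UNIV. \<Sum>j\<in>UNIV - {i}. z j * (k i j * (y j - y i)))"
    by (simp add: sum.distrib[symmetric] algebra_simps)
  also have "(\<Sum>i\<in>UNIV. \<Sum>j\<in>UNIV - {i}. z j * (k i j * (y j - y i))) =
      (\<Sum>i\<in>UNIV. \<Sum>j\<in>UNIV - {i}. z i * (k j i * (y i - y j)))"
    by (rule sum_off_diagonal_swap)
  also have "\<dots> = (\<Sum>i\<in>UNIV. \<Sum>j\<in>UNIV - {i}. z i * (k i j * (y i - y j)))"
    by (intro sum.cong refl) (use sym in auto)
  finally show ?thesis
    by (simp add: sum_distrib_left)
qed

text \<open>
  The pointwise energy balance. The left-hand side is the time derivative of the Hamiltonian by the
  chain rule, where \<open>a i j\<close> stands for the derivative of \<open>\<theta> i j\<close> in its \<open>i\<close>-th coordinate. The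
  conservative parts of the two equations cancel and only the damping survives.
\<close>

lemma power_balance:
  fixes w k a :: "'a::finite \<Rightarrow> 'a \<Rightarrow> real" and x' y y' u :: "'a \<Rightarrow> real"
  assumes w: "\<And>i j. w i j = w j i" and k: "\<And>i j. i \<noteq> j \<Longrightarrow> k i j = k j i"
    and x': "\<And>i. x' i + (\<Sum>j\<in>UNIV - {i}. w i j * k i j * (y j - y i)) = 0"
    and y': "\<And>i. y' i + c * y i +
               (1 / 2) * (\<Sum>j\<in>UNIV - {i}. w i j * a i j * (y i - y j)\<^sup>2) + u i = 0"
  shows "(1 / 4) * (\<Sum>i\<in>UNIV. \<Sum>j\<in>UNIV - {i}. w i j *
             ((a i j * x' i + a j i * x' j) * (y i - y j)\<^sup>2 +
              k i j * (2 * (y i - y j) * (y' i - y' j)))) +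
           (\<Sum>i\<in>UNIV. u i * x' i) =
         - (c / 2) * (\<Sum>i\<in>UNIV. \<Sum>j\<in>UNIV - {i}. w i j * k i j * (y i - y j)\<^sup>2)"
    (is "(1 / 4) * ?L + _ = _")
proof -
  define S where "S i = (\<Sum>j\<in>UNIV - {i}. w i j * a i j * (y i - y j)\<^sup>2)" for i
  have flux: "(\<Sum>j\<in>UNIV - {i}. w i j * k i j * (y i - y j)) = x' i" for i
  proof -
    have "(\<Sum>j\<in>UNIV - {i}. w i j * k i j * (y i - y j)) =
        - (\<Sum>j\<in>UNIV - {i}. w i j * k i j * (y j - y i))"
      by (simp add: sum_negf[symmetric] algebra_simps)
    then show ?thesis
      using x'[of i] by simp
  qed
  have green: "(\<Sum>i\<in>UNIV. \<Sum>j\<in>UNIV - {i}. w i j * k i j * (y i - y j) * (z i - z j)) =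
      2 * (\<Sum>i\<in>UNIV. z i * x' i)" for z
  proof -
    have "w i j * k i j = w j i * k j i" if "i \<noteq> j" for i j
      using w[of i j] k[OF that] by simp
    from graph_green_formula[of "\<lambda>i j. w i j * k i j" y z, OF this] show ?thesis
      by (simp add: flux)
  qed
  have swap: "(\<Sum>i\<in>UNIV. \<Sum>j\<in>UNIV - {i}. w i j * a j i * x' j * (y i - y j)\<^sup>2) =
      (\<Sum>i\<in>UNIV. x' i * S i)"
  proof -
    have "(\<Sum>i\<in>UNIV. \<Sum>j\<in>UNIV - {i}. w i j * a j i * x' j * (y i - y j)\<^sup>2) =
        (\<Sum>i\<in>UNIV. \<Sum>j\<in>UNIV - {i}. w j i * a i j * x' i * (y j - y i)\<^sup>2)"
      by (rule sum_off_diagonal_swap)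
    also have "\<dots> = (\<Sum>i\<in>UNIV. x' i * S i)"
      unfolding S_def sum_distrib_left
      by (intro sum.cong refl) (simp add: w power2_commute[of "y _" "y _"] mult_ac)
    finally show ?thesis .
  qed
  have "?L = (\<Sum>i\<in>UNIV. \<Sum>j\<in>UNIV - {i}. w i j * a i j * x' i * (y i - y j)\<^sup>2) +
      (\<Sum>i\<in>UNIV. \<Sum>j\<in>UNIV - {i}. w i j * a j i * x' j * (y i - y j)\<^sup>2) +
      2 * (\<Sum>i\<in>UNIV. \<Sum>j\<in>UNIV - {i}. w i j * k i j * (y i - y j) * (y' i - y' j))"
    unfolding sum_distrib_left sum.distrib[symmetric]
    by (intro sum.cong refl) (simp add: algebra_simps)
  also have "(\<Sum>i\<in>UNIV. \<Sum>j\<in>UNIV - {i}. w i j * a i j * x' i * (y i - y j)\<^sup>2) =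
      (\<Sum>i\<in>UNIV. x' i * S i)"
    unfolding S_def sum_distrib_left by (intro sum.cong refl) (simp add: mult_ac)
  finally have "(1 / 4) * ?L + (\<Sum>i\<in>UNIV. u i * x' i) =
      (\<Sum>i\<in>UNIV. x' i * S i) / 2 + (\<Sum>i\<in>UNIV. y' i * x' i) + (\<Sum>i\<in>UNIV. u i * x' i)"
    unfolding swap green by simp
  also have "\<dots> = (\<Sum>i\<in>UNIV. (- c) * (y i * x' i))"
    unfolding sum_divide_distrib sum.distrib[symmetric]
  proof (intro sum.cong refl)
    fix i
    have eq: "y' i = - c * y i - S i / 2 - u i"
      using y'[of i] unfolding S_def by simp
    show "x' i * S i / 2 + y' i * x' i + u i * x' i = (- c) * (y i * x' i)"
      unfolding eq by (simp add: algebra_simps)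
  qed
  also have "\<dots> = - (c / 2) * (2 * (\<Sum>i\<in>UNIV. y i * x' i))"
    by (simp add: sum_distrib_left sum_negf)
  also have "2 * (\<Sum>i\<in>UNIV. y i * x' i) =
      (\<Sum>i\<in>UNIV. \<Sum>j\<in>UNIV - {i}. w i j * k i j * (y i - y j)\<^sup>2)"
    unfolding green[symmetric] by (simp add: power2_eq_square mult_ac)
  finally show ?thesis .
qed

section \<open>Derivatives of the potential and of the mobilities\<close>

lemma open_pos_orthant: "open (pos_orthant :: (real ^ 'n) set)"
proof -
  have "pos_orthant = (\<Inter>i. {p :: real ^ 'n. 0 < p $ i})"
    by (auto simp: pos_orthant_def)
  also have "open \<dots>"
    by (intro open_INT ballI open_Collect_less continuous_intros) simp
  finally show ?thesis .
qed

lemma eventually_shift_mem_open: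
  fixes q v :: "'a::real_normed_vector"
  assumes "open S" "q \<in> S"
  shows "eventually (\<lambda>h::real. q + h *\<^sub>R v \<in> S) (nhds 0)"
proof -
  have "((\<lambda>h::real. q + h *\<^sub>R v) \<longlongrightarrow> q + 0 *\<^sub>R v) (nhds 0)"
    by (intro tendsto_intros filterlim_ident)
  then show ?thesis
    using assms by (auto dest: topological_tendstoD)
qed

lemma partial_deriv_cong:
  assumes "open S" "q \<in> S" "\<And>x. x \<in> S \<Longrightarrow> g x = h x"
  shows "partial_deriv g i q = partial_deriv h i q"
  unfolding partial_deriv_def
  by (rule deriv_cong_ev[OF eventually_mono[OF eventually_shift_mem_open[OF assms(1,2)]] refl])
    (rule assms(3))

lemma C1_on_has_derivative_partial:
  fixes g :: "real ^ 'n \<Rightarrow> real"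
  assumes "C1_on S g" "q \<in> S"
  shows "(g has_derivative (\<lambda>h. \<Sum>i\<in>UNIV. partial_deriv g i q * h $ i)) (at q)"
proof -
  obtain D where D: "(g has_derivative (\<lambda>h. D q \<bullet> h)) (at q)"
    using assms unfolding C1_on_def by blast
  have "partial_deriv g i q = D q $ i" for i
  proof -
    have "((\<lambda>h::real. q + h *\<^sub>R axis i 1) has_derivative (\<lambda>h. h *\<^sub>R axis i 1)) (at 0)"
      by (auto intro!: derivative_eq_intros)
    moreover have "(g has_derivative (\<lambda>h. D q \<bullet> h)) (at (q + 0 *\<^sub>R axis i 1))"
      using D by simp
    ultimately have "((\<lambda>h::real. g (q + h *\<^sub>R axis i 1)) has_derivative
        (\<lambda>h. D q \<bullet> (h *\<^sub>R axis i 1))) (at 0)"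
      by (rule has_derivative_compose)
    then have "((\<lambda>h::real. g (q + h *\<^sub>R axis i 1)) has_field_derivative D q $ i) (at 0)"
      unfolding has_field_derivative_def
      by (rule has_derivative_eq_rhs) (simp add: inner_axis mult.commute fun_eq_iff)
    then show ?thesis
      unfolding partial_deriv_def by (rule DERIV_imp_deriv)
  qed
  then show ?thesis
    using D by (simp add: inner_vec_def)
qed

text \<open>
  A mobility is a function of its two end points only, because it is constant or given by the
  density ratios there; its other partial derivatives vanish.
\<close>

lemma mobility_has_derivative:
  fixes \<pi> :: "real ^ 'n"
  assumes \<theta>: "mobility_weights \<pi> \<theta>" and ij: "i \<noteq> j" and q: "q \<in> pos_orthant"
  shows "(\<theta> i j has_derivative
           (\<lambda>h. partial_deriv (\<theta> i j) i q * h $ i + partial_deriv (\<theta> j i) j q * h $ j)) (at q)"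
proof -
  have C1: "C1_on pos_orthant (\<theta> i j)"
    and sym: "\<And>x. x \<in> pos_orthant \<Longrightarrow> \<theta> i j x = \<theta> j i x"
    using \<theta> ij unfolding mobility_weights_def by blast+
  have local: "\<theta> i j x = \<theta> i j q"
    if "x \<in> pos_orthant" "x $ i = q $ i" "x $ j = q $ j" for x
    using \<theta> ij q that unfolding mobility_weights_def by force
  have zero: "partial_deriv (\<theta> i j) l q = 0" if "l \<noteq> i" "l \<noteq> j" for l
  proof -
    have "eventually (\<lambda>h. \<theta> i j (q + h *\<^sub>R axis l 1) = \<theta> i j q) (nhds (0::real))"
      by (rule eventually_mono[OF eventually_shift_mem_open[OF open_pos_orthant q]])
        (rule local, use that in \<open>auto simp: axis_def\<close>)
    then have "deriv (\<lambda>h. \<theta> i j (q + h *\<^sub>R axis l 1)) 0 = deriv (\<lambda>_. \<theta> i j q) (0::real)"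
      by (rule deriv_cong_ev) simp
    then show ?thesis
      by (simp add: partial_deriv_def)
  qed
  have "(\<Sum>l\<in>UNIV. partial_deriv (\<theta> i j) l q * h $ l) =
      (\<Sum>l\<in>{i, j}. partial_deriv (\<theta> i j) l q * h $ l)" for h
    by (rule sum.mono_neutral_right) (auto simp: zero)
  then have "(\<Sum>l\<in>UNIV. partial_deriv (\<theta> i j) l q * h $ l) =
      partial_deriv (\<theta> i j) i q * h $ i + partial_deriv (\<theta> j i) j q * h $ j" for h
    using ij partial_deriv_cong[OF open_pos_orthant q sym] by simp
  then show ?thesis
    using C1_on_has_derivative_partial[OF C1 q] by simp
qed

section \<open>Mass and energy along solutions\<close>

lemma edge_weight_sym:
  "reversible_rates \<pi> Q \<Longrightarrow> edge_weight \<pi> Q i j = edge_weight \<pi> Q j i"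
  by (simp add: reversible_rates_def edge_weight_def)

lemma edge_weight_nonneg:
  assumes "\<And>i. 0 < \<pi> $ i" "rate_matrix Q" "i \<noteq> j"
  shows "0 \<le> edge_weight \<pi> Q i j"
  using assms by (simp add: rate_matrix_def edge_weight_def less_imp_le)

text \<open>
  On an interval starting at \<open>0\<close> that need not be open, the mean value theorem is applied on the
  compact interval from \<open>0\<close> to \<open>t\<close>, where one-sided derivatives suffice.
\<close>

lemma interval_mvt:
  fixes f :: "real \<Rightarrow> real"
  assumes "is_interval I" "0 \<in> I" "I \<subseteq> {0..}" "t \<in> I"
    and "\<And>s. s \<in> I \<Longrightarrow> (f has_vector_derivative f' s) (at s within I)"
  obtains s where "s \<in> I" "f t - f 0 = t * f' s"
proof -
  have sub: "{0..t} \<subseteq> I"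
    using mem_is_interval_1_I[OF assms(1,2,4)] by auto
  have "0 \<le> t"
    using assms by auto
  have "(f has_derivative (\<lambda>h. h * f' s)) (at s within {0..t})" if "0 \<le> s" "s \<le> t" for s
    using has_vector_derivative_within_subset[OF assms(5)[of s] sub] that sub
    by (auto simp: has_vector_derivative_def)
  from mvt_very_simple[OF \<open>0 \<le> t\<close> this] obtain s where "s \<in> {0..t}" "f t - f 0 = t * f' s"
    by auto
  with sub that show ?thesis
    by blast
qed

lemma damped_solution_mass:
  assumes sol: "damped_solution \<omega> \<theta> U \<gamma> I p \<psi>"
    and \<omega>: "\<And>i j. \<omega> i j = \<omega> j i"
    and \<theta>: "\<And>i j q. i \<noteq> j \<Longrightarrow> q \<in> pos_orthant \<Longrightarrow> \<theta> i j q = \<theta> j i q"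
    and t: "t \<in> I"
  shows "(\<Sum>i\<in>UNIV. p t $ i) = (\<Sum>i\<in>UNIV. p 0 $ i)"
proof -
  obtain p' where I: "is_interval I" "0 \<in> I" "I \<subseteq> {0..}"
    and pos: "\<And>t. t \<in> I \<Longrightarrow> p t \<in> pos_orthant"
    and p': "\<And>t. t \<in> I \<Longrightarrow> (p has_vector_derivative p' t) (at t within I)"
    and eq: "\<And>t i. t \<in> I \<Longrightarrow> p' t $ i +
               (\<Sum>j\<in>UNIV - {i}. \<omega> i j * \<theta> i j (p t) * (\<psi> t $ j - \<psi> t $ i)) = 0"
    using sol unfolding damped_solution_def by blast
  have "((\<lambda>t. \<Sum>i\<in>UNIV. p t $ i) has_vector_derivative (\<Sum>i\<in>UNIV. p' s $ i)) (at s within I)"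
    if "s \<in> I" for s
    by (intro has_vector_derivative_sum bounded_linear.has_vector_derivative[OF
          bounded_linear_vec_nth p'[OF that]])
  from interval_mvt[OF I t this] obtain s where s: "s \<in> I"
    "(\<Sum>i\<in>UNIV. p t $ i) - (\<Sum>i\<in>UNIV. p 0 $ i) = t * (\<Sum>i\<in>UNIV. p' s $ i)"
    by blast
  define k where "k i j = \<omega> i j * \<theta> i j (p s)" for i j
  have k: "k i j = k j i" if "i \<noteq> j" for i j
    using \<omega>[of i j] \<theta>[OF that pos[OF s(1)]] by (simp add: k_def)
  have "p' s $ i = (\<Sum>j\<in>UNIV - {i}. k i j * (\<psi> s $ i - \<psi> s $ j))" for i
  proof -
    have "(\<Sum>j\<in>UNIV - {i}. k i j * (\<psi> s $ i - \<psi> s $ j)) =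
        - (\<Sum>j\<in>UNIV - {i}. k i j * (\<psi> s $ j - \<psi> s $ i))"
      by (simp add: sum_negf[symmetric] algebra_simps)
    then show ?thesis
      using eq[OF s(1), of i] unfolding k_def by simp
  qed
  \<comment> \<open>The total flux is the pairing of the Laplacian with the constant function \<open>1\<close>.\<close>
  then have "(\<Sum>i\<in>UNIV. p' s $ i) = 0"
    using graph_green_formula[of k "\<lambda>i. \<psi> s $ i" "\<lambda>_. 1", OF k] by simp
  with s show ?thesis
    by simp
qed

lemma hamiltonian_antimono:
  fixes \<pi> :: "real ^ 'n"
  assumes sol: "damped_solution \<omega> \<theta> U \<gamma> I p \<psi>"
    and \<omega>: "\<And>i j. \<omega> i j = \<omega> j i" "\<And>i j. i \<noteq> j \<Longrightarrow> 0 \<le> \<omega> i j"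
    and \<theta>: "mobility_weights \<pi> \<theta>"
    and U: "C1_on pos_orthant U"
    and \<gamma>: "\<And>t. t \<in> I \<Longrightarrow> 0 < \<gamma> t"
    and t: "t \<in> I"
  shows "hamiltonian \<omega> \<theta> U (p t) (\<psi> t) \<le> hamiltonian \<omega> \<theta> U (p 0) (\<psi> 0)"
proof -
  obtain p' \<psi>' where I: "is_interval I" "0 \<in> I" "I \<subseteq> {0..}"
    and pos: "\<And>t. t \<in> I \<Longrightarrow> p t \<in> pos_orthant"
    and p': "\<And>t. t \<in> I \<Longrightarrow> (p has_vector_derivative p' t) (at t within I)"
    and \<psi>': "\<And>t. t \<in> I \<Longrightarrow> (\<psi> has_vector_derivative \<psi>' t) (at t within I)"
    and eq: "\<And>t i. t \<in> I \<Longrightarrow> p' t $ i +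
               (\<Sum>j\<in>UNIV - {i}. \<omega> i j * \<theta> i j (p t) * (\<psi> t $ j - \<psi> t $ i)) = 0"
      "\<And>t i. t \<in> I \<Longrightarrow> \<psi>' t $ i + \<gamma> t * \<psi> t $ i +
               (1 / 2) * (\<Sum>j\<in>UNIV - {i}.
                  \<omega> i j * partial_deriv (\<theta> i j) i (p t) * (\<psi> t $ i - \<psi> t $ j)\<^sup>2) +
               partial_deriv U i (p t) = 0"
    using sol unfolding damped_solution_def by blast
  define E where "E s = (\<Sum>i\<in>UNIV. \<Sum>j\<in>UNIV - {i}.
    \<omega> i j * \<theta> i j (p s) * (\<psi> s $ i - \<psi> s $ j)\<^sup>2)" for s
  have deriv: "((\<lambda>s. hamiltonian \<omega> \<theta> U (p s) (\<psi> s)) has_vector_derivative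
      - (\<gamma> s / 2) * E s) (at s within I)" if s: "s \<in> I" for s
  proof -
    have d\<psi>: "((\<lambda>s. \<psi> s $ i) has_field_derivative \<psi>' s $ i) (at s within I)" for i
      using bounded_linear.has_vector_derivative[OF bounded_linear_vec_nth \<psi>'[OF s]]
      by (simp add: has_real_derivative_iff_has_vector_derivative)
    have d\<theta>: "((\<lambda>s. \<theta> i j (p s)) has_field_derivative
        partial_deriv (\<theta> i j) i (p s) * p' s $ i + partial_deriv (\<theta> j i) j (p s) * p' s $ j)
        (at s within I)" if "i \<noteq> j" for i j
      using vector_derivative_diff_chain_within[OF p'[OF s]
          has_derivative_at_withinI[OF mobility_has_derivative[OF \<theta> that pos[OF s]]]]
      by (simp add: has_real_derivative_iff_has_vector_derivative o_def)
    have dU: "((\<lambda>s. U (p s)) has_field_derivative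
        (\<Sum>i\<in>UNIV. partial_deriv U i (p s) * p' s $ i)) (at s within I)"
      using vector_derivative_diff_chain_within[OF p'[OF s]
          has_derivative_at_withinI[OF C1_on_has_derivative_partial[OF U pos[OF s]]]]
      by (simp add: has_real_derivative_iff_has_vector_derivative o_def)
    have summand: "((\<lambda>s. \<omega> i j * \<theta> i j (p s) * (\<psi> s $ i - \<psi> s $ j)\<^sup>2) has_field_derivative
        \<omega> i j * ((partial_deriv (\<theta> i j) i (p s) * p' s $ i +
            partial_deriv (\<theta> j i) j (p s) * p' s $ j) * (\<psi> s $ i - \<psi> s $ j)\<^sup>2 +
          \<theta> i j (p s) * (2 * (\<psi> s $ i - \<psi> s $ j) * (\<psi>' s $ i - \<psi>' s $ j)))) (at s within I)"
      if "j \<in> UNIV - {i}" for i j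
      using that by (auto intro!: derivative_eq_intros d\<theta> d\<psi> simp: algebra_simps)
    have energy: "((\<lambda>s. hamiltonian \<omega> \<theta> U (p s) (\<psi> s)) has_field_derivative
        (1 / 4) * (\<Sum>i\<in>UNIV. \<Sum>j\<in>UNIV - {i}. \<omega> i j *
          ((partial_deriv (\<theta> i j) i (p s) * p' s $ i +
            partial_deriv (\<theta> j i) j (p s) * p' s $ j) * (\<psi> s $ i - \<psi> s $ j)\<^sup>2 +
          \<theta> i j (p s) * (2 * (\<psi> s $ i - \<psi> s $ j) * (\<psi>' s $ i - \<psi>' s $ j)))) +
        (\<Sum>i\<in>UNIV. partial_deriv U i (p s) * p' s $ i)) (at s within I)"
      unfolding hamiltonian_def
      by (intro DERIV_add DERIV_cmult DERIV_sum summand dU)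
    have \<theta>_sym: "\<theta> i j (p s) = \<theta> j i (p s)" if "i \<noteq> j" for i j
      using \<theta> that pos[OF s] unfolding mobility_weights_def by blast
    show ?thesis
      unfolding has_real_derivative_iff_has_vector_derivative[symmetric] E_def
      by (rule DERIV_cong[OF energy], rule power_balance[where k = "\<lambda>i j. \<theta> i j (p s)"
            and x' = "\<lambda>i. p' s $ i" and y = "\<lambda>i. \<psi> s $ i" and y' = "\<lambda>i. \<psi>' s $ i"
            and a = "\<lambda>i j. partial_deriv (\<theta> i j) i (p s)"
            and u = "\<lambda>i. partial_deriv U i (p s)"])
        (assumption | rule \<omega>(1) \<theta>_sym eq[OF s])+
  qed
  from interval_mvt[OF I t deriv] obtain s where s: "s \<in> I"
    "hamiltonian \<omega> \<theta> U (p t) (\<psi> t) - hamiltonian \<omega> \<theta> U (p 0) (\<psi> 0) = t * (- (\<gamma> s / 2) * E s)"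
    by blast
  have "0 \<le> E s"
    unfolding E_def
    by (intro sum_nonneg mult_nonneg_nonneg zero_le_power2)
      (use \<omega>(2) \<theta> pos[OF s(1)] in \<open>auto simp: mobility_weights_def less_imp_le\<close>)
  then have "0 \<le> t * (\<gamma> s / 2 * E s)"
    using I(3) t \<gamma>[OF s(1)] by (intro mult_nonneg_nonneg) auto
  with s(2) show ?thesis
    by simp
qed

section \<open>The potential as a barrier\<close>

text \<open>
  One step of propagation: below \<open>a\<close>, every \<open>F x\<close> with \<open>a \<le> x\<close> lies above the single function
  \<open>F a\<close>, so the blow-up of \<open>F a\<close> alone gives a bound \<open>b\<close> that is uniform in \<open>x\<close>.
\<close>

lemma barrier:
  fixes F :: "real \<Rightarrow> real \<Rightarrow> real"
  assumes blowup: "filterlim (F a) at_top (at_right 0)"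
    and mono: "\<And>r0 r r1. 0 < r0 \<Longrightarrow> 0 < r \<Longrightarrow> r \<le> r0 \<Longrightarrow> r0 < r1 \<Longrightarrow> F r0 r < F r1 r"
    and a: "0 < a"
  obtains b where "0 < b" "\<And>x y. a \<le> x \<Longrightarrow> 0 < y \<Longrightarrow> F x y \<le> M \<Longrightarrow> b \<le> y"
proof -
  have "eventually (\<lambda>y. M < F a y) (at_right 0)"
    using blowup by (simp add: filterlim_at_top_dense)
  then obtain c where c: "0 < c" "\<And>y. 0 < y \<Longrightarrow> y < c \<Longrightarrow> M < F a y"
    unfolding eventually_at_right_field by auto
  \<comment> \<open>The comparison with \<open>F a\<close> is available for \<open>y \<le> a\<close> only, hence the minimum.\<close>
  have "min a c \<le> y" if "a \<le> x" "0 < y" "F x y \<le> M" for x y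
  proof (rule ccontr)
    assume "\<not> min a c \<le> y"
    then have y: "y \<le> a" "y < c"
      by auto
    have "M < F a y"
      using c(2) that(2) y(2) by blast
    also have "F a y \<le> F x y"
      using mono[OF a that(2) y(1), of x] that(1) by (cases "x = a") auto
    finally show False
      using that(3) by simp
  qed
  with a c(1) that show ?thesis
    by (meson min_less_iff_conj)
qed

text \<open>
  The bounds are quantified before \<open>r\<close>: they are uniform over the whole sublevel set of the
  potential.
\<close>

lemma barrier_along_path:
  fixes F :: "real \<Rightarrow> real \<Rightarrow> real" and M :: "'a \<Rightarrow> 'a \<Rightarrow> real"
  assumes blowup: "\<And>r0. 0 < r0 \<Longrightarrow> filterlim (F r0) at_top (at_right 0)"
    and mono: "\<And>r0 r r1. 0 < r0 \<Longrightarrow> 0 < r \<Longrightarrow> r \<le> r0 \<Longrightarrow> r0 < r1 \<Longrightarrow> F r0 r < F r1 r"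
    and path: "(i, j) \<in> R\<^sup>*" and a: "0 < a"
  shows "\<exists>b>0. \<forall>r. (\<forall>k. 0 < r k) \<and> (\<forall>(k, l)\<in>R. F (r k) (r l) \<le> M k l) \<and> a \<le> r i \<longrightarrow> b \<le> r j"
  using path
proof (induction rule: rtrancl_induct)
  case base
  show ?case
    by (intro exI[of _ a] conjI allI impI a) (elim conjE)
next
  case (step k l)
  from step.IH obtain b where b: "0 < b"
    "\<forall>r. (\<forall>k. 0 < r k) \<and> (\<forall>(k, l)\<in>R. F (r k) (r l) \<le> M k l) \<and> a \<le> r i \<longrightarrow> b \<le> r k"
    by (elim exE conjE) (rule that)
  obtain c where c: "0 < c" "\<And>x y. b \<le> x \<Longrightarrow> 0 < y \<Longrightarrow> F x y \<le> M k l \<Longrightarrow> c \<le> y"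
    by (rule barrier[where F = F and a = b and M = "M k l", OF blowup[OF b(1)] mono b(1)]) blast+
  show ?case
  proof (intro exI[of _ c] conjI allI impI)
    fix r
    assume r: "(\<forall>k. 0 < r k) \<and> (\<forall>(k, l)\<in>R. F (r k) (r l) \<le> M k l) \<and> a \<le> r i"
    then have "0 < r l" and edge: "\<forall>(k, l)\<in>R. F (r k) (r l) \<le> M k l"
      by simp_all
    moreover have "F (r k) (r l) \<le> M k l"
      using bspec[OF edge step.hyps(2)] by simp
    moreover have "b \<le> r k"
      using b(2) r by (elim allE[of _ r]) (rule mp)
    ultimately show "c \<le> r l"
      using c(2) by simp
  qed (rule c(1))
qed

text \<open>
  The diagonal weights \<open>edge_weight \<pi> Q i i\<close> may be negative, but \<open>F\<close> vanishes on the diagonal, so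
  all terms of the potential are nonnegative and each is bounded by the whole.
\<close>

lemma graph_potential_edge_bound:
  fixes \<pi> :: "real ^ 'n"
  assumes \<pi>: "\<And>i. 0 < \<pi> $ i" and q: "q \<in> pos_orthant"
    and F: "\<And>r0 r. 0 < r0 \<Longrightarrow> 0 < r \<Longrightarrow> 0 \<le> F r0 r \<and> (F r0 r = 0 \<longleftrightarrow> r = r0)"
    and \<omega>: "\<And>i j. i \<noteq> j \<Longrightarrow> 0 \<le> \<omega> i j"
    and bound: "graph_potential F \<pi> \<omega> q \<le> C" and kl: "0 < \<omega> k l"
  shows "F (q $ k / \<pi> $ k) (q $ l / \<pi> $ l) \<le> 4 * C / \<omega> k l"
proof -
  define T where "T i j = F (q $ i / \<pi> $ i) (q $ j / \<pi> $ j) * \<omega> i j" for i j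
  have r: "0 < q $ i / \<pi> $ i" for i
    using \<pi> q by (simp add: pos_orthant_def)
  have T: "0 \<le> T i j" for i j
    using F[OF r r, of i j] \<omega>[of i j] by (cases "i = j") (auto simp: T_def)
  have "T k l \<le> (\<Sum>j\<in>UNIV. T k j)"
    by (rule member_le_sum) (auto simp: T)
  also have "\<dots> \<le> (\<Sum>i\<in>UNIV. \<Sum>j\<in>UNIV. T i j)"
    by (rule member_le_sum[where f = "\<lambda>i. \<Sum>j\<in>UNIV. T i j"]) (auto intro!: sum_nonneg T)
  also have "\<dots> \<le> 4 * C"
    using bound by (simp add: graph_potential_def T_def)
  finally show ?thesis
    using kl by (simp add: T_def pos_le_divide_eq)
qed

lemma graph_potential_sublevel_lower_bound:
  fixes \<pi> :: "real ^ 'n" and Q :: "real ^ 'n ^ 'n"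
  assumes \<pi>: "\<pi> \<in> prob_simplex" "\<And>i. 0 < \<pi> $ i"
    and Q: "rate_matrix Q" "irreducible_rates Q"
    and F: "\<And>r0 r. 0 < r0 \<Longrightarrow> 0 < r \<Longrightarrow> 0 \<le> F r0 r \<and> (F r0 r = 0 \<longleftrightarrow> r = r0)"
    and blowup: "\<And>r0. 0 < r0 \<Longrightarrow> filterlim (F r0) at_top (at_right 0)"
    and mono: "\<And>r0 r r1. 0 < r0 \<Longrightarrow> 0 < r \<Longrightarrow> r \<le> r0 \<Longrightarrow> r0 < r1 \<Longrightarrow> F r0 r < F r1 r"
  shows "\<exists>\<epsilon>>0. \<forall>q \<in> pos_orthant. (\<Sum>i\<in>UNIV. q $ i) = 1 \<longrightarrow>
           graph_potential F \<pi> (edge_weight \<pi> Q) q \<le> C \<longrightarrow> (\<forall>i. \<epsilon> < q $ i)"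
proof -
  define R where "R = {(k, l). 0 < Q $ k $ l}"
  define M where "M k l = 4 * C / edge_weight \<pi> Q k l" for k l
  have "(i, j) \<in> R\<^sup>*" for i j
    using Q(2) unfolding irreducible_rates_def R_def by (cases "i = j") auto
  then have "\<exists>b>0. \<forall>r. (\<forall>k. 0 < r k) \<and> (\<forall>(k, l)\<in>R. F (r k) (r l) \<le> M k l) \<and> 1 \<le> r i
      \<longrightarrow> b \<le> r j" for i j
    by (intro barrier_along_path[where F = F] blowup mono) simp_all
  moreover define low_energy where
    "low_energy r \<longleftrightarrow> (\<forall>k. 0 < r k) \<and> (\<forall>(k, l)\<in>R. F (r k) (r l) \<le> M k l)" for r
  ultimately have "\<exists>b>0. \<forall>r. low_energy r \<and> 1 \<le> r i \<longrightarrow> b \<le> r j" for i j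
    by (simp only: low_energy_def conj_assoc)
  then obtain b where b: "\<And>i j. 0 < b i j" "\<And>i j r. low_energy r \<Longrightarrow> 1 \<le> r i \<Longrightarrow> b i j \<le> r j"
    by metis
  define B where "B = range (\<lambda>(i, j). b i j * \<pi> $ j)"
  have B: "finite B" "B \<noteq> {}"
    by (auto simp: B_def)
  have "0 < Min B"
    using b(1) \<pi>(2) by (subst Min_gr_iff[OF B]) (auto simp: B_def)
  \<comment> \<open>The path bounds are not strict; halving makes the final bound strict.\<close>
  moreover have "Min B / 2 < q $ j"
    if q: "q \<in> pos_orthant" and mass: "(\<Sum>i\<in>UNIV. q $ i) = 1"
      and bound: "graph_potential F \<pi> (edge_weight \<pi> Q) q \<le> C" for q j
  proof -
    have "\<exists>i. 1 \<le> q $ i / \<pi> $ i"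
    proof (rule ccontr)
      assume "\<nexists>i. 1 \<le> q $ i / \<pi> $ i"
      then have ratio: "q $ i / \<pi> $ i < 1" for i
        by (simp add: not_le)
      have "q $ i < \<pi> $ i" for i
        using ratio[of i] \<pi>(2)[of i] by (simp add: pos_divide_less_eq)
      then have "(\<Sum>i\<in>UNIV. q $ i) < (\<Sum>i\<in>UNIV. \<pi> $ i)"
        by (intro sum_strict_mono) auto
      then show False
        using mass \<pi>(1) by (simp add: prob_simplex_def)
    qed
    then obtain i where i: "1 \<le> q $ i / \<pi> $ i" ..
    have "F (q $ k / \<pi> $ k) (q $ l / \<pi> $ l) \<le> M k l" if "(k, l) \<in> R" for k l
      unfolding M_def
      by (rule graph_potential_edge_bound[where F = F, OF \<pi>(2) q F _ bound])
        (use that \<pi>(2) edge_weight_nonneg[OF \<pi>(2) Q(1)] in \<open>auto simp: R_def edge_weight_def\<close>)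
    then have "low_energy (\<lambda>k. q $ k / \<pi> $ k)"
      using q \<pi>(2) unfolding low_energy_def pos_orthant_def by auto
    then have "b i j \<le> q $ j / \<pi> $ j"
      using b(2)[of "\<lambda>k. q $ k / \<pi> $ k"] i by blast
    then have "b i j * \<pi> $ j \<le> q $ j"
      using \<pi>(2)[of j] by (simp add: pos_le_divide_eq)
    moreover have "Min B \<le> b i j * \<pi> $ j"
      by (rule Min_le[OF B(1)]) (auto simp: B_def)
    ultimately show ?thesis
      using \<open>0 < Min B\<close> by linarith
  qed
  ultimately show ?thesis
    by (intro exI[of _ "Min B / 2"]) auto
qed

section \<open>Positivity along solutions\<close>

theorem theorem5:
  fixes \<pi> :: "real ^ 'n"
    and Q :: "real ^ 'n ^ 'n"
    and \<omega> :: "'n \<Rightarrow> 'n \<Rightarrow> real"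
    and \<theta> :: "'n \<Rightarrow> 'n \<Rightarrow> real ^ 'n \<Rightarrow> real"
    and F :: "real \<Rightarrow> real \<Rightarrow> real"
    and U :: "real ^ 'n \<Rightarrow> real"
    and \<gamma> :: "real \<Rightarrow> real"
    and I :: "real set"
    and p \<psi> :: "real \<Rightarrow> real ^ 'n"
    and C :: real
  assumes "\<pi> \<in> prob_simplex" and "\<And>i. 0 < \<pi> $ i"
    and "rate_matrix Q" and "irreducible_rates Q" and "reversible_rates \<pi> Q"
    and "\<omega> = edge_weight \<pi> Q"
    and "mobility_weights \<pi> \<theta>"
    and "\<And>r0 r. 0 < r0 \<Longrightarrow> 0 < r \<Longrightarrow> 0 \<le> F r0 r \<and> (F r0 r = 0 \<longleftrightarrow> r = r0)"
    and "\<And>r0. 0 < r0 \<Longrightarrow> filterlim (F r0) at_top (at_right 0)"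
    and "\<And>r0. 0 < r0 \<Longrightarrow> strict_antimono_on {0<..r0} (F r0)"
    and "\<And>r0 r r1. 0 < r0 \<Longrightarrow> 0 < r \<Longrightarrow> r \<le> r0 \<Longrightarrow> r0 < r1 \<Longrightarrow> F r0 r < F r1 r"
    and "U = graph_potential F \<pi> \<omega>"
    and "admissible_potential \<pi> U"
    and "\<And>t. t \<in> I \<Longrightarrow> 0 < \<gamma> t"
    and "damped_solution \<omega> \<theta> U \<gamma> I p \<psi>"
    and "p 0 \<in> prob_simplex"
    and "hamiltonian \<omega> \<theta> U (p 0) (\<psi> 0) \<le> C"
    and "\<And>i. 0 < p 0 $ i"
  shows "\<exists>\<epsilon>>0. \<forall>i. \<forall>t\<in>I. \<epsilon> < p t $ i"
proof -
  note \<pi> = assms(1,2) and Q = assms(3-5) and \<omega>_def = assms(6) and \<theta> = assms(7)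
  note F = assms(8) and blowup = assms(9) and mono = assms(11) and U_def = assms(12)
  have \<omega>_sym: "\<omega> i j = \<omega> j i" for i j
    unfolding \<omega>_def by (rule edge_weight_sym[OF Q(3)])
  have \<omega>_nonneg: "0 \<le> \<omega> i j" if "i \<noteq> j" for i j
    unfolding \<omega>_def by (rule edge_weight_nonneg[OF \<pi>(2) Q(1) that])
  have "\<exists>\<epsilon>>0. \<forall>q \<in> pos_orthant. (\<Sum>i\<in>UNIV. q $ i) = 1 \<longrightarrow> U q \<le> C \<longrightarrow> (\<forall>i. \<epsilon> < q $ i)"
    unfolding U_def \<omega>_def
    by (rule graph_potential_sublevel_lower_bound[OF \<pi> Q(1,2)])
      (assumption | rule F blowup mono)+
  then obtain \<epsilon> where \<epsilon>: "0 < \<epsilon>" "\<And>q i. q \<in> pos_orthant \<Longrightarrow> (\<Sum>i\<in>UNIV. q $ i) = 1 \<Longrightarrow>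
      U q \<le> C \<Longrightarrow> \<epsilon> < q $ i"
    by blast
  have "\<epsilon> < p t $ i" if t: "t \<in> I" for t i
  proof (rule \<epsilon>(2))
    show pos: "p t \<in> pos_orthant"
      using assms(15) t by (simp add: damped_solution_def)
    show "(\<Sum>i\<in>UNIV. p t $ i) = 1"
      using damped_solution_mass[OF assms(15) \<omega>_sym _ t] \<theta> assms(16)
      by (simp add: mobility_weights_def prob_simplex_def)
    have "0 \<le> (\<Sum>i\<in>UNIV. \<Sum>j\<in>UNIV - {i}. \<omega> i j * \<theta> i j (p t) * (\<psi> t $ i - \<psi> t $ j)\<^sup>2)"
      by (intro sum_nonneg mult_nonneg_nonneg zero_le_power2)
        (use \<omega>_nonneg \<theta> pos in \<open>auto simp: mobility_weights_def less_imp_le\<close>)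
    then have "U (p t) \<le> hamiltonian \<omega> \<theta> U (p t) (\<psi> t)"
      by (simp add: hamiltonian_def)
    also have "\<dots> \<le> hamiltonian \<omega> \<theta> U (p 0) (\<psi> 0)"
      using assms(13) by (intro hamiltonian_antimono[OF assms(15) \<omega>_sym \<omega>_nonneg \<theta> _ assms(14) t])
        (simp_all add: admissible_potential_def)
    also have "\<dots> \<le> C"
      by (rule assms(17))
    finally show "U (p t) \<le> C" .
  qed
  then show ?thesis
    using \<epsilon>(1) by blast
qed

end
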